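(* For $n\in\mathbb{N}$ let $Q_n$ be the distribution of $z_{n+1}/Z_n$ with respect to the Bernoulli measure $\mathbb{P}$, i.e. $Q_n(A)=\mathbb{P}\left(\omega: z_{n+1}(\omega)/Z_n(\omega)\in A\right)$ for Borel sets $A\subset\mathbb{R}$. Then $(Q_n)_{n\in\mathbb{N}}$ fulfills the Large Deviation Principle with normalising sequence $\mathbb{N}$ (that is, $a_n=n$) and rate function $I_p$ given for $q>0$ by $$I_p(q):=-(C+1)\log(C+1)+C\log C-\log p-\left((1+q)C+q\right)\log(1-p),$$ where $C=C_p(q):=\left((1-p)^{-q-1}-1\right)^{-1}$, and, for $q\le 0$, by $I_p(q)=+\infty$. The rate function $I_p$ is strictly increasing and concave on $(0,\infty)$.
   Context: $\mathbb{N}=\{1,2,3,\dots\}$. Let $\omega=(\omega_i)_{i\in\mathbb{N}}$ be a Bernoulli process over the symbol space $\{1,\dots,r\}$ with probability vector $(p_1,\dots,p_r)$, i.e. under $\mathbb{P}$ the $\omega_i$ are i.i.d. with $\mathbb{P}(\omega_i=j)=p_j$. Fix a symbol $k\in\{1,\dots,r\}$ with $p:=p_k\in(0,1)$. Let $Z_0:=0$ and, for $n\ge1$, let $Z_n(\omega):=\inf\{\ell\in\mathbb{N}:\ell>Z_{n-1}(\omega),\ \omega_\ell=k\}$ (the $n$-th total waiting time) and $z_n(\omega):=Z_n(\omega)-Z_{n-1}(\omega)$ (the $n$-th waiting time). Large Deviation Principle: Let $\mathcal{H}$ be a complete separable metric space (here $\mathbb{R}$), $\mathcal{B}(\mathcal{H})$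 its Borel $\sigma$-algebra, and $(Q_n)_{n\in\mathbb{N}}$ a sequence of Borel probability measures on $\mathcal{B}(\mathcal{H})$. $(Q_n)$ fulfills a Large Deviation Principle with normalising sequence $(a_n)_{n\in\mathbb{N}}$ of positive reals, $a_n\to\infty$, and rate function $I:\mathcal{H}\to[0,\infty]$ if: (1) $I$ is lower semi-continuous on $\mathcal{H}$; (2) $I$ has compact level sets; (3) $\limsup_{n\to\infty}a_n^{-1}\ln Q_n(K)\le-\inf_{x\in K}I(x)$ for all closed sets $K\subset\mathcal{H}$; (4) $\liminf_{n\to\infty}a_n^{-1}\ln Q_n(G)\ge-\inf_{x\in G}I(x)$ for all open sets $G\subset\mathcal{H}$.
   Formalization: Since I_p(q) tends to 0 as q decreases to 0, I_p(0)=+∞ violates lower semi-continuity and compact level sets; the full LDP is proved with I_p(0):=0 instead, and the upper and lower bounds (3), (4) also for I_p as printed. *)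

theory Defs
  imports "HOL-Probability.Probability"
begin

section \<open>Large deviation principles\<close>

text \<open>The real \<open>ln\<close> has \<open>ln 0 = 0\<close>; null sets need the value \<open>-\<infinity>\<close>.\<close>

definition ext_ln :: "real \<Rightarrow> ereal" where
  "ext_ln x = (if x = 0 then -\<infinity> else ereal (ln x))"

definition lower_semicontinuous :: "('h::topological_space \<Rightarrow> ereal) \<Rightarrow> bool" where
  "lower_semicontinuous I \<longleftrightarrow> (\<forall>x. I x \<le> Liminf (at x) I)"

definition ld_upper_bound ::
    "(nat \<Rightarrow> real) \<Rightarrow> (nat \<Rightarrow> 'h::topological_space measure) \<Rightarrow> ('h \<Rightarrow> ereal) \<Rightarrow> bool" where
  "ld_upper_bound a Q I \<longleftrightarrow>
     (\<forall>K. closed K \<longrightarrow>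
        limsup (\<lambda>n. ext_ln (measure (Q n) K) / ereal (a n)) \<le> - (INF x\<in>K. I x))"

definition ld_lower_bound ::
    "(nat \<Rightarrow> real) \<Rightarrow> (nat \<Rightarrow> 'h::topological_space measure) \<Rightarrow> ('h \<Rightarrow> ereal) \<Rightarrow> bool" where
  "ld_lower_bound a Q I \<longleftrightarrow>
     (\<forall>G. open G \<longrightarrow>
        - (INF x\<in>G. I x) \<le> liminf (\<lambda>n. ext_ln (measure (Q n) G) / ereal (a n)))"

text \<open>Sequences are indexed by the positive integers, so index \<open>0\<close> is unconstrained.\<close>

definition large_deviation_principle ::
    "(nat \<Rightarrow> real) \<Rightarrow> (nat \<Rightarrow> 'h::polish_space measure) \<Rightarrow> ('h \<Rightarrow> ereal) \<Rightarrow> bool" where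
  "large_deviation_principle a Q I \<longleftrightarrow>
     (\<forall>n\<ge>1. prob_space (Q n) \<and> sets (Q n) = sets borel) \<and>
     (\<forall>n\<ge>1. 0 < a n) \<and> filterlim a at_top sequentially \<and>
     (\<forall>x. 0 \<le> I x) \<and>
     lower_semicontinuous I \<and>
     (\<forall>c::real. compact {x. I x \<le> ereal c}) \<and>
     ld_upper_bound a Q I \<and>
     ld_lower_bound a Q I"

section \<open>Bernoulli processes and waiting times\<close>

text \<open>
  The symbols \<open>\<omega> 1, \<omega> 2, \<dots>\<close> are independent random variables with values in \<open>{1..r}\<close>;
  measurability into \<open>count_space {1..r}\<close> is part of \<open>indep_vars\<close>. The coordinate process on the
  sequence space is the special case in which \<open>M\<close> is the product measure.
\<close>

definition bernoulli_process ::
    "'w measure \<Rightarrow> nat \<Rightarrow> (nat \<Rightarrow> real) \<Rightarrow> (nat \<Rightarrow> 'w \<Rightarrow> nat) \<Rightarrow> bool" where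
  "bernoulli_process M r P \<omega> \<longleftrightarrow>
     prob_space M \<and>
     (\<forall>j\<in>{1..r}. 0 \<le> P j) \<and> (\<Sum>j=1..r. P j) = 1 \<and>
     prob_space.indep_vars M (\<lambda>_. count_space {1..r}) \<omega> {1..} \<and>
     (\<forall>i\<ge>1. \<forall>j\<in>{1..r}. measure M {x \<in> space M. \<omega> i x = j} = P j)"

text \<open>
  Both functions take a single sequence of symbols \<open>s\<close>, of which only \<open>s 1, s 2, \<dots>\<close> matter.
  On sequences with finitely many occurrences of \<open>k\<close> (a null event when \<open>k\<close> has positive
  probability) the infimum of the empty set is \<open>0\<close> instead of \<open>\<infinity>\<close>.
\<close>

primrec total_waiting_time :: "nat \<Rightarrow> (nat \<Rightarrow> nat) \<Rightarrow> nat \<Rightarrow> nat" where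
  "total_waiting_time k s 0 = 0"
| "total_waiting_time k s (Suc n) = Inf {l. l > total_waiting_time k s n \<and> s l = k}"

definition waiting_time :: "nat \<Rightarrow> (nat \<Rightarrow> nat) \<Rightarrow> nat \<Rightarrow> nat" where
  "waiting_time k s n = total_waiting_time k s n - total_waiting_time k s (n - 1)"

definition waiting_ratio_distr ::
    "'w measure \<Rightarrow> (nat \<Rightarrow> 'w \<Rightarrow> nat) \<Rightarrow> nat \<Rightarrow> nat \<Rightarrow> real measure" where
  "waiting_ratio_distr M \<omega> k n =
     distr M borel (\<lambda>x. real (waiting_time k (\<lambda>i. \<omega> i x) (n + 1)) /
                        real (total_waiting_time k (\<lambda>i. \<omega> i x) n))"

section \<open>The rate function\<close>

definition rate_C :: "real \<Rightarrow> real \<Rightarrow> real" where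
  "rate_C p q = inverse ((1 - p) powr (- q - 1) - 1)"

definition rate_formula :: "real \<Rightarrow> real \<Rightarrow> real" where
  "rate_formula p q =
     (let C = rate_C p q in
        - (C + 1) * ln (C + 1) + C * ln C - ln p - ((1 + q) * C + q) * ln (1 - p))"

definition rate_fun :: "real \<Rightarrow> real \<Rightarrow> ereal" where
  "rate_fun p q = (if q > 0 then ereal (rate_formula p q) else \<infinity>)"

text \<open>
  \<open>rate_fun p q\<close> tends to \<open>0\<close> as \<open>q\<close> decreases to \<open>0\<close>, whereas \<open>rate_fun p 0 = \<infinity>\<close>: the function
  is not lower semicontinuous at \<open>0\<close>, so it is not itself a rate function in the sense of
  \<open>large_deviation_principle\<close>. Its lower semicontinuous envelope has the value \<open>0\<close> at \<open>0\<close>.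
\<close>

definition rate_fun_lsc :: "real \<Rightarrow> real \<Rightarrow> ereal" where
  "rate_fun_lsc p = (rate_fun p)(0 := 0)"

end

theory Submission
  imports Defs "HOL-Real_Asymp.Real_Asymp"
begin

text \<open>
  A logarithmic computation turns the rate formula into
    \<open>J q = ln ((1 - p) powr (- q) - (1 - p)) - ln p\<close>
  (\<open>rate_formula_eq_explicit_rate\<close>). Hence \<open>J 0 = 0\<close>, and \<open>J\<close> is continuous, strictly increasing and
  unbounded on \<open>{0..}\<close>, and concave. Moreover \<open>exp (- J q) = \<phi> ((1 - p) powr q)\<close>, where
  \<open>\<phi> s = p s / (1 - (1 - p) s)\<close> is the generating function of the geometric law with parameter \<open>p\<close>.

  The reason for the large deviation principle is that the tails of the ratio can be computed almost
  exactly. Given \<open>Z\<^sub>n = m\<close>, the event that the next waiting time exceeds \<open>q m\<close> has probability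
  \<open>(1 - p) powr (q m)\<close>, up to rounding \<open>q m\<close> to an integer, i.e. up to a factor between \<open>1\<close> and
  \<open>1 / (1 - p)\<close>. Averaging over \<open>m\<close> gives the generating function of \<open>Z\<^sub>n\<close> at \<open>s = (1 - p) powr q\<close>.
  Since \<open>Z\<^sub>n\<close> is a sum of \<open>n\<close> independent geometric variables, this is \<open>\<phi> s ^ n = exp (- n J q)\<close>. So
  both tails, \<open>{q<..}\<close> and \<open>{q..}\<close> with \<open>q \<ge> 0\<close>, have mass between \<open>exp (- n J q)\<close> and \<open>exp (- n J q) / (1 - p)\<close>
  (\<open>lower_tail\<close>, \<open>upper_tail\<close>).

  Such tail bounds imply the large deviation principle for any strictly increasing, continuous, unbounded \<open>J\<close> (locale
  \<open>exponential_tails\<close>): a closed set is contained, up to a null set, in the tail that starts at the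
  infimum of its positive part, and an open set around \<open>x\<close> contains a difference of two tails starting
  at \<open>x\<close> and slightly to the right of \<open>x\<close>, of which the second is exponentially smaller. Whether the
  rate at \<open>0\<close> is \<open>0\<close> or \<open>\<infinity>\<close> affects semicontinuity, but neither of the two bounds.
\<close>

section \<open>The rate function\<close>

text \<open>
  This is \<open>rate_formula p\<close> with \<open>C\<close> eliminated. All analytic properties of the rate are read off
  from this form, and it also displays the rate as minus the logarithm of a generating function.
\<close>

definition explicit_rate :: "real \<Rightarrow> real \<Rightarrow> real" where
  "explicit_rate p q = ln ((1 - p) powr (- q) - (1 - p)) - ln p"

lemma powr_minus_gt:
  fixes b :: real
  assumes "0 < b" "b < 1" "0 \<le> q"
  shows "b < b powr (- q)"
proof -
  have "b powr 1 < b powr (- q)"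
    using assms by (intro powr_less_mono') auto
  thus ?thesis using assms by simp
qed

text \<open>
  With \<open>b = 1 - p\<close> and \<open>E = b powr (- q - 1)\<close> one has \<open>C = 1 / (E - 1)\<close> and \<open>C + 1 = E C\<close>, so every
  logarithm is a combination of \<open>ln b\<close> and \<open>ln (E - 1)\<close>; the multiples of \<open>C\<close> cancel.
\<close>

lemma rate_formula_eq_explicit_rate:
  assumes "0 < p" "p < 1" "0 \<le> q"
  shows "rate_formula p q = explicit_rate p q"
proof -
  define b where "b = 1 - p"
  define E where "E = b powr (- q - 1)"
  have b: "0 < b" "b < 1" using assms by (auto simp: b_def)
  have bE: "b * E = b powr (- q)"
    using b by (simp add: E_def powr_diff)
  hence E: "1 < E" using powr_minus_gt[OF b assms(3)] b
    by (metis less_numeral_extra(3) mult.right_neutral mult_less_cancel_left_pos)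
  have lnE: "ln E = - (1 + q) * ln b" using b by (simp add: E_def ln_powr algebra_simps)
  define C where "C = inverse (E - 1)"
  have C: "0 < C" "C + 1 = E * C" using E by (auto simp: C_def field_simps)
  have lnC: "ln C = - ln (E - 1)" using E by (simp add: C_def ln_inverse)
  have lnC1: "ln (C + 1) = ln E + ln C" using C E by (simp add: ln_mult)
  have "rate_formula p q = - (C + 1) * ln (C + 1) + C * ln C - ln p - ((1 + q) * C + q) * ln b"
    by (simp add: rate_formula_def Let_def rate_C_def C_def E_def b_def)
  also have "\<dots> = ln b + ln (E - 1) - ln p"
    unfolding lnC1 lnE lnC by (simp add: algebra_simps)
  also have "ln b + ln (E - 1) = ln (b * (E - 1))" using b E by (simp add: ln_mult)
  also have "b * (E - 1) = b powr (- q) - b" using bE by (simp add: algebra_simps)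
  finally show ?thesis by (simp add: explicit_rate_def b_def)
qed

lemma explicit_rate_0 [simp]:
  assumes "0 < p" "p < 1"
  shows "explicit_rate p 0 = 0"
  using assms by (simp add: explicit_rate_def)

text \<open>
  The right-hand side is the generating function \<open>p s / (1 - (1 - p) s)\<close> of a geometric random
  variable, taken at \<open>s = (1 - p) powr q\<close>. This is the link between the rate and the waiting times.
\<close>

lemma exp_minus_explicit_rate:
  assumes "0 < p" "p < 1" "0 \<le> q"
  shows "exp (- explicit_rate p q) =
    p * (1 - p) powr q / (1 - (1 - p) * (1 - p) powr q)"
proof -
  have g: "1 - p < (1 - p) powr (- q)" using assms by (intro powr_minus_gt) auto
  have "exp (- explicit_rate p q) = p / ((1 - p) powr (- q) - (1 - p))"
    using g assms by (simp add: explicit_rate_def exp_diff)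
  also have "\<dots> = p * (1 - p) powr q / (1 - (1 - p) * (1 - p) powr q)"
    using assms g by (simp add: powr_minus divide_simps algebra_simps)
  finally show ?thesis .
qed

lemma strict_mono_on_explicit_rate:
  assumes "0 < p" "p < 1"
  shows "strict_mono_on {0..} (explicit_rate p)"
proof (rule strict_mono_onI)
  fix x y :: real assume xy: "x \<in> {0..}" "y \<in> {0..}" "x < y"
  have "(1 - p) powr (- x) < (1 - p) powr (- y)"
    using assms xy by (intro powr_less_mono') auto
  moreover have "1 - p < (1 - p) powr (- x)" using assms xy by (intro powr_minus_gt) auto
  ultimately show "explicit_rate p x < explicit_rate p y"
    by (simp add: explicit_rate_def)
qed

lemma continuous_on_explicit_rate:
  assumes "0 < p" "p < 1"
  shows "continuous_on {0..} (explicit_rate p)"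
proof -
  have "(1 - p) powr (- q) - (1 - p) \<noteq> 0" if "q \<in> {0..}" for q
    using powr_minus_gt[of "1 - p" q] assms that by simp
  thus ?thesis
    unfolding explicit_rate_def using assms by (intro continuous_intros) auto
qed

lemma filterlim_explicit_rate_at_top:
  assumes "0 < p" "p < 1"
  shows "filterlim (explicit_rate p) at_top at_top"
proof -
  define a where "a = - ln (1 - p)"
  have a: "0 < a" using assms by (simp add: a_def)
  have "explicit_rate p = (\<lambda>q. ln (exp (a * q) - (1 - p)) - ln p)"
    using assms by (auto simp: explicit_rate_def powr_def a_def mult.commute)
  moreover have "filterlim (\<lambda>q. ln (exp (a * q) - (1 - p)) - ln p) at_top at_top"
    using a by real_asymp
  ultimately show ?thesis by simp
qed

text \<open>
  The derivative \<open>- ln b / (1 - b powr (q + 1))\<close>, where \<open>b = 1 - p\<close>, is decreasing in \<open>q\<close>.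
\<close>

lemma concave_on_explicit_rate:
  assumes "0 < p" "p < 1"
  shows "concave_on {0..} (explicit_rate p)"
proof -
  define b where "b = 1 - p"
  have b: "0 < b" "b < 1" using assms by (auto simp: b_def)
  have pos: "0 < 1 - b * b powr q" if "0 \<le> q" for q
    using powr_minus_gt[OF b that] b by (simp add: powr_minus field_simps)
  show ?thesis
  proof (rule f''_le0_imp_concave)
    fix q :: real assume q: "q \<in> {0..}"
    have g: "b < b powr (- q)" using b q by (intro powr_minus_gt) auto
    show "(explicit_rate p has_real_derivative - ln b / (1 - b * b powr q)) (at q)"
      unfolding explicit_rate_def b_def[symmetric]
      by (rule derivative_eq_intros refl | use b g pos[of q] q in
        \<open>simp add: powr_minus divide_simps algebra_simps\<close>)+
    show "((\<lambda>q. - ln b / (1 - b * b powr q)) has_real_derivative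
       - (b * b powr q * (ln b)\<^sup>2) / (1 - b * b powr q)\<^sup>2) (at q)"
      by (rule derivative_eq_intros refl | use b g pos[of q] q in
        \<open>simp add: power2_eq_square\<close>)+
    show "- (b * b powr q * (ln b)\<^sup>2) / (1 - b * b powr q)\<^sup>2 \<le> 0"
      using b by (simp add: divide_nonneg_nonneg)
  qed simp
qed

section \<open>Large deviations from exponential tail bounds\<close>

lemma ext_ln_le:
  assumes "0 \<le> x" "x \<le> exp y"
  shows "ext_ln x \<le> ereal y"
proof (cases "x = 0")
  case False
  hence "ln x \<le> ln (exp y)" using assms by (intro ln_mono) auto
  with False show ?thesis by (simp add: ext_ln_def)
qed (simp add: ext_ln_def)

lemma ext_ln_ge:
  assumes "exp y \<le> x"
  shows "ereal y \<le> ext_ln x"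
proof -
  have "0 < x" using assms exp_gt_zero[of y] by linarith
  thus ?thesis using assms by (simp add: ext_ln_def ln_ge_iff)
qed

lemma ereal_divide_nat_mono:
  assumes "a \<le> b" "0 < (n::nat)"
  shows "a / ereal (real n) \<le> b / ereal (real n)"
  using assms by (intro ereal_divide_right_mono) auto

text \<open>
  Measures on the positive half-line whose tails decay like \<open>exp (- n J q)\<close> up to a constant factor.
  The constant is invisible on the scale \<open>1 / n\<close>, and since \<open>J\<close> is increasing, the mass of a set is
  governed by its leftmost point in the half-line.
\<close>

locale exponential_tails =
  fixes Q :: "nat \<Rightarrow> real measure" and J :: "real \<Rightarrow> real" and c :: real
  assumes prob: "1 \<le> n \<Longrightarrow> prob_space (Q n)"
    and sets_Q: "1 \<le> n \<Longrightarrow> sets (Q n) = sets borel"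
    and support: "1 \<le> n \<Longrightarrow> measure (Q n) {..0} = 0"
    and J_0: "J 0 = 0"
    and J_strict: "strict_mono_on {0..} J"
    and J_cont: "continuous_on {0..} J"
    and J_top: "filterlim J at_top at_top"
    and lower_tail: "1 \<le> n \<Longrightarrow> 0 \<le> q \<Longrightarrow> exp (- real n * J q) \<le> measure (Q n) {q<..}"
    and upper_tail: "1 \<le> n \<Longrightarrow> 0 \<le> q \<Longrightarrow> measure (Q n) {q..} \<le> c * exp (- real n * J q)"
begin

text \<open>
  The value at \<open>0\<close> is \<open>J 0 = 0\<close>, which makes this function lower semicontinuous. The large
  deviation bounds do not distinguish it from \<open>rate(0 := \<infinity>)\<close>: the point \<open>0\<close> carries no mass, and an open set
  containing \<open>0\<close> contains small positive points, where the rate is close to \<open>0\<close>.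
\<close>

definition rate :: "real \<Rightarrow> ereal" where
  "rate q = (if 0 \<le> q then ereal (J q) else \<infinity>)"

lemma J_nonneg: "0 \<le> q \<Longrightarrow> 0 \<le> J q"
  using strict_mono_onD[OF J_strict, of 0 q] J_0 by (cases "q = 0") auto

lemma c_pos: "0 < c"
proof -
  have "0 < exp (- real 1 * J 0)" by simp
  also have "\<dots> \<le> measure (Q 1) {0<..}" by (rule lower_tail) auto
  also have "\<dots> \<le> measure (Q 1) {0..}"
  proof -
    interpret prob_space "Q 1" by (rule prob) simp
    have "sets (Q 1) = sets borel" by (rule sets_Q) simp
    thus ?thesis by (intro finite_measure_mono) auto
  qed
  also have "\<dots> \<le> c * exp (- real 1 * J 0)" by (rule upper_tail) auto
  finally show ?thesis by (simp add: zero_less_mult_iff)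
qed

text \<open>
  Let \<open>m\<close> be the infimum of the positive part of \<open>K\<close>. Apart from a null set, \<open>K\<close> lies in \<open>{m..}\<close>, and
  by continuity of \<open>J\<close> the infimum of the rate over \<open>K\<close> does not exceed \<open>J m\<close>, even if \<open>m = 0\<close> is not
  a positive point of \<open>K\<close>.
\<close>

lemma limsup_le_off_zero:
  fixes K :: "real set"
  assumes "closed K"
  shows "limsup (\<lambda>n. ext_ln (measure (Q n) K) / ereal (real n))
    \<le> - (INF x\<in>K. (rate(0 := \<infinity>)) x)"
proof (cases "K \<inter> {0<..} = {}")
  case True
  have "limsup (\<lambda>n. ext_ln (measure (Q n) K) / ereal (real n)) \<le> limsup (\<lambda>n. -\<infinity>)"
  proof (rule Limsup_mono, rule eventually_sequentiallyI[of 1])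
    fix n :: nat assume n: "1 \<le> n"
    interpret prob_space "Q n" using n by (rule prob)
    have "measure (Q n) K \<le> measure (Q n) {..0}"
      using True n assms by (intro finite_measure_mono) (auto simp: sets_Q)
    hence "measure (Q n) K = 0" using support[OF n] by (simp add: measure_le_0_iff)
    thus "ext_ln (measure (Q n) K) / ereal (real n) \<le> -\<infinity>" using n by (simp add: ext_ln_def)
  qed
  thus ?thesis by (simp add: Limsup_const)
next
  case False
  define S where "S = K \<inter> {0<..}"
  define m where "m = Inf S"
  have bdd: "bdd_below S" by (rule bdd_belowI[of _ 0]) (auto simp: S_def)
  have m: "0 \<le> m" unfolding m_def using False by (intro cInf_greatest) (auto simp: S_def)
  have mS: "m \<le> x" if "x \<in> S" for x unfolding m_def using bdd that by (intro cInf_lower)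
  have INF_le: "(INF x\<in>K. (rate(0 := \<infinity>)) x) \<le> ereal (J m)"
  proof (rule ereal_le_epsilon2)
    fix e :: real assume "0 < e"
    then obtain d where d: "0 < d" "\<And>x. 0 \<le> x \<Longrightarrow> dist x m < d \<Longrightarrow> dist (J x) (J m) < e"
      using J_cont m unfolding continuous_on_iff by (metis atLeast_iff)
    obtain x where x: "x \<in> S" "x < m + d"
      using cInf_lessD[of S "m + d"] False d(1) by (auto simp: S_def m_def)
    have "dist (J x) (J m) < e" using x mS[of x] m by (intro d(2)) (auto simp: dist_real_def)
    hence "J x \<le> J m + e" by (simp add: dist_real_def)
    moreover have "(INF x\<in>K. (rate(0 := \<infinity>)) x) \<le> (rate(0 := \<infinity>)) x"
      using x by (intro INF_lower) (auto simp: S_def)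
    moreover have "(rate(0 := \<infinity>)) x = ereal (J x)" using x by (simp add: S_def rate_def)
    ultimately show "(INF x\<in>K. (rate(0 := \<infinity>)) x) \<le> ereal (J m) + ereal e"
      by (metis ereal_less_eq(3) order_trans plus_ereal.simps(1))
  qed
  have "limsup (\<lambda>n. ext_ln (measure (Q n) K) / ereal (real n))
      \<le> limsup (\<lambda>n. ereal (ln c / real n - J m))"
  proof (rule Limsup_mono, rule eventually_sequentiallyI[of 1])
    fix n :: nat assume n: "1 \<le> n"
    interpret prob_space "Q n" using n by (rule prob)
    have "measure (Q n) K \<le> measure (Q n) ({..0} \<union> {m..})"
      using mS n by (intro finite_measure_mono) (force simp: sets_Q S_def)+
    also have "\<dots> \<le> measure (Q n) {..0} + measure (Q n) {m..}"
      using n by (intro measure_subadditive) (auto simp: sets_Q)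
    also have "\<dots> \<le> c * exp (- real n * J m)" using upper_tail[OF n m] support[OF n] by simp
    also have "\<dots> = exp (ln c - real n * J m)" using c_pos by (simp add: exp_diff exp_minus field_simps)
    finally have "ext_ln (measure (Q n) K) \<le> ereal (ln c - real n * J m)"
      by (intro ext_ln_le) auto
    hence "ext_ln (measure (Q n) K) / ereal (real n) \<le> ereal (ln c - real n * J m) / ereal (real n)"
      using n by (intro ereal_divide_nat_mono) auto
    thus "ext_ln (measure (Q n) K) / ereal (real n) \<le> ereal (ln c / real n - J m)"
      using n by (simp add: field_simps)
  qed
  also have "\<dots> = ereal (- J m)"
    by (intro lim_imp_Limsup tendsto_ereal) (simp, real_asymp)
  also have "\<dots> \<le> - (INF x\<in>K. (rate(0 := \<infinity>)) x)"
    using INF_le by (metis ereal_minus_le_minus uminus_ereal.simps(1))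
  finally show ?thesis .
qed

lemma ld_upper_bound_off_zero: "ld_upper_bound real Q (rate(0 := \<infinity>))"
  unfolding ld_upper_bound_def using limsup_le_off_zero by blast

lemma ld_upper_bound_rate: "ld_upper_bound real Q rate"
  unfolding ld_upper_bound_def
proof (intro allI impI)
  fix K :: "real set" assume "closed K"
  hence "limsup (\<lambda>n. ext_ln (measure (Q n) K) / ereal (real n)) \<le> - (INF x\<in>K. (rate(0 := \<infinity>)) x)"
    by (rule limsup_le_off_zero)
  also have "(INF x\<in>K. rate x) \<le> (INF x\<in>K. (rate(0 := \<infinity>)) x)" by (intro INF_mono) auto
  hence "- (INF x\<in>K. (rate(0 := \<infinity>)) x) \<le> - (INF x\<in>K. rate x)" by simp
  finally show "limsup (\<lambda>n. ext_ln (measure (Q n) K) / ereal (real n)) \<le> - (INF x\<in>K. rate x)" .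
qed

text \<open>
  The interval \<open>{x<..<y}\<close> inside \<open>G\<close> has mass at least \<open>exp (- n J x) - c exp (- n J y)\<close>. As
  \<open>J x < J y\<close>, the second term is eventually less than half of the first. Only points to the right
  of \<open>x\<close> are used, which covers the boundary point \<open>x = 0\<close>.
\<close>

lemma liminf_ge:
  assumes G: "open G" "x \<in> G" and x: "0 \<le> x"
  shows "ereal (- J x) \<le> liminf (\<lambda>n. ext_ln (measure (Q n) G) / ereal (real n))"
proof -
  obtain e where e: "0 < e" "ball x e \<subseteq> G" using G openE by blast
  define y where "y = x + e / 2"
  have y: "x < y" "{x<..<y} \<subseteq> G" using e by (auto simp: y_def dist_real_def subset_iff)
  define d where "d = J y - J x"
  have d: "0 < d" using strict_mono_onD[OF J_strict, of x y] x y by (simp add: d_def)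
  have "((\<lambda>n. c * exp (- real n * d)) \<longlongrightarrow> 0) sequentially" using d by real_asymp
  hence small: "\<forall>\<^sub>F n in sequentially. c * exp (- real n * d) < 1 / 2"
    by (rule order_tendstoD) simp
  have "ereal (- J x) = liminf (\<lambda>n. ereal (- ln 2 / real n - J x))"
    by (intro lim_imp_Liminf[symmetric] tendsto_ereal) (simp, real_asymp)
  also have "\<dots> \<le> liminf (\<lambda>n. ext_ln (measure (Q n) G) / ereal (real n))"
  proof (rule Liminf_mono,
      rule eventually_mono[OF eventually_conj[OF small eventually_ge_at_top[of 1]]], elim conjE)
    fix n :: nat assume s: "c * exp (- real n * d) < 1 / 2" and n: "1 \<le> n"
    interpret prob_space "Q n" using n by (rule prob)
    have "exp (- real n * J y) = exp (- real n * J x) * exp (- real n * d)"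
      by (simp add: d_def exp_add[symmetric] algebra_simps)
    hence "c * exp (- real n * J y) = exp (- real n * J x) * (c * exp (- real n * d))" by simp
    also have "\<dots> \<le> exp (- real n * J x) * (1 / 2)" using s by (intro mult_left_mono) auto
    finally have half: "c * exp (- real n * J y) \<le> exp (- real n * J x) / 2" by simp
    have "exp (- ln 2 - real n * J x) = exp (- real n * J x) / 2"
      by (simp add: exp_diff exp_minus field_simps)
    also have "\<dots> \<le> exp (- real n * J x) - c * exp (- real n * J y)" using half by simp
    also have "\<dots> \<le> measure (Q n) {x<..} - measure (Q n) {y..}"
      using lower_tail[OF n x] upper_tail[OF n, of y] x y by simp
    also have "\<dots> = measure (Q n) ({x<..} - {y..})"
      using n y by (intro finite_measure_Diff[symmetric]) (auto simp: sets_Q)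
    also have "\<dots> \<le> measure (Q n) G"
      using n y G(1) by (intro finite_measure_mono) (auto simp: sets_Q subset_iff not_le)
    finally have "ereal (- ln 2 - real n * J x) \<le> ext_ln (measure (Q n) G)" by (rule ext_ln_ge)
    hence "ereal (- ln 2 - real n * J x) / ereal (real n) \<le> ext_ln (measure (Q n) G) / ereal (real n)"
      using n by (intro ereal_divide_nat_mono) auto
    thus "ereal (- ln 2 / real n - J x) \<le> ext_ln (measure (Q n) G) / ereal (real n)"
      using n by (simp add: field_simps)
  qed
  finally show ?thesis .
qed

lemma ld_lower_bound_rate: "ld_lower_bound real Q rate"
  unfolding ld_lower_bound_def
proof (intro allI impI)
  fix G :: "real set" assume G: "open G"
  define L where "L = liminf (\<lambda>n. ext_ln (measure (Q n) G) / ereal (real n))"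
  have "- L \<le> (INF x\<in>G. rate x)"
  proof (rule INF_greatest)
    fix x assume x: "x \<in> G"
    show "- L \<le> rate x"
    proof (cases "0 \<le> x")
      case True
      have "- L \<le> - ereal (- J x)"
        unfolding ereal_minus_le_minus L_def using G x True by (rule liminf_ge)
      thus ?thesis using True by (simp add: rate_def)
    qed (simp add: rate_def)
  qed
  thus "- (INF x\<in>G. rate x) \<le> liminf (\<lambda>n. ext_ln (measure (Q n) G) / ereal (real n))"
    unfolding L_def by (simp add: ereal_uminus_le_reorder)
qed

lemma ld_lower_bound_off_zero: "ld_lower_bound real Q (rate(0 := \<infinity>))"
  unfolding ld_lower_bound_def
proof (intro allI impI)
  fix G :: "real set" assume G: "open G"
  have "(INF x\<in>G. rate x) \<le> (INF x\<in>G. (rate(0 := \<infinity>)) x)" by (intro INF_mono) auto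
  hence "- (INF x\<in>G. (rate(0 := \<infinity>)) x) \<le> - (INF x\<in>G. rate x)" by simp
  also have "\<dots> \<le> liminf (\<lambda>n. ext_ln (measure (Q n) G) / ereal (real n))"
    using ld_lower_bound_rate G unfolding ld_lower_bound_def by blast
  finally show "- (INF x\<in>G. (rate(0 := \<infinity>)) x)
      \<le> liminf (\<lambda>n. ext_ln (measure (Q n) G) / ereal (real n))" .
qed

lemma compact_sublevel: "compact {x. rate x \<le> ereal a}"
proof -
  obtain b where b: "\<And>x. b \<le> x \<Longrightarrow> a < J x"
    using J_top by (auto simp: filterlim_at_top_dense eventually_at_top_linorder)
  have eq: "{x. rate x \<le> ereal a} = {x \<in> {0..}. J x \<le> a}" by (auto simp: rate_def)
  have "closed {x \<in> {0..}. J x \<le> a}"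
    using continuous_on_closed_Collect_le[OF J_cont continuous_on_const] by simp
  moreover have "{x \<in> {0..}. J x \<le> a} \<subseteq> {0..b}" using b by (fastforce simp flip: not_less)
  hence "bounded {x \<in> {0..}. J x \<le> a}" using bounded_closed_interval bounded_subset by blast
  ultimately show ?thesis unfolding eq by (simp add: compact_eq_bounded_closed)
qed

lemma lower_semicontinuous_rate: "lower_semicontinuous rate"
  unfolding lower_semicontinuous_def
proof
  fix x :: real
  show "rate x \<le> Liminf (at x) rate"
    unfolding le_Liminf_iff
  proof (intro allI impI)
    fix y assume y: "y < rate x"
    have "open {z. y < rate z}"
    proof (cases y)
      case (real r)
      have "closed {z. rate z \<le> ereal r}" by (intro compact_imp_closed compact_sublevel)
      moreover have "{z. y < rate z} = - {z. rate z \<le> ereal r}" using real by auto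
      ultimately show ?thesis by (simp add: open_Compl)
    next
      case PInf thus ?thesis by simp
    next
      case MInf
      hence "{z. y < rate z} = UNIV" by (auto simp: rate_def)
      thus ?thesis by simp
    qed
    thus "\<forall>\<^sub>F z in at x. y < rate z"
      using y by (auto intro!: eventually_at_topological[THEN iffD2] exI[of _ "{z. y < rate z}"])
  qed
qed

theorem large_deviation_principle_rate: "large_deviation_principle real Q rate"
  unfolding large_deviation_principle_def
  using prob sets_Q lower_semicontinuous_rate compact_sublevel ld_upper_bound_rate
    ld_lower_bound_rate J_nonneg
  by (auto simp: rate_def filterlim_real_sequentially)

end

section \<open>Waiting times along a recurrent sequence\<close>

text \<open>
  On sequences in which \<open>k\<close> occurs infinitely often every infimum in \<open>total_waiting_time\<close> is attained;
  almost every sample path is of this kind.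
\<close>

definition recurs :: "nat \<Rightarrow> (nat \<Rightarrow> nat) \<Rightarrow> bool" where
  "recurs k s \<longleftrightarrow> (\<forall>m. \<exists>l>m. s l = k)"

lemma total_waiting_time_Suc_hits:
  assumes "recurs k s"
  shows "total_waiting_time k s n < total_waiting_time k s (Suc n)"
    and "s (total_waiting_time k s (Suc n)) = k"
proof -
  have "{l. l > total_waiting_time k s n \<and> s l = k} \<noteq> {}"
    using assms by (auto simp: recurs_def)
  from Inf_nat_def1[OF this] show "total_waiting_time k s n < total_waiting_time k s (Suc n)"
    and "s (total_waiting_time k s (Suc n)) = k" by auto
qed

lemma total_waiting_time_Suc_le:
  assumes "total_waiting_time k s n < l" "s l = k"
  shows "total_waiting_time k s (Suc n) \<le> l"
  using assms by (auto intro!: cInf_lower)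

lemma less_waiting_time_iff:
  assumes "recurs k s"
  shows "j < waiting_time k s (Suc n) \<longleftrightarrow>
    (\<forall>l\<in>{total_waiting_time k s n <.. total_waiting_time k s n + j}. s l \<noteq> k)"
proof -
  let ?t = "total_waiting_time k s"
  note hits = total_waiting_time_Suc_hits[OF assms, of n]
  have "j < waiting_time k s (Suc n) \<longleftrightarrow> ?t n + j < ?t (Suc n)"
    using hits(1) unfolding waiting_time_def diff_Suc_1 by linarith
  also have "\<dots> \<longleftrightarrow> (\<forall>l\<in>{?t n <.. ?t n + j}. s l \<noteq> k)"
  proof
    assume less: "?t n + j < ?t (Suc n)"
    show "\<forall>l\<in>{?t n <.. ?t n + j}. s l \<noteq> k"
    proof
      fix l assume "l \<in> {?t n <.. ?t n + j}"
      thus "s l \<noteq> k" using less total_waiting_time_Suc_le[of k s n l] by fastforce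
    qed
  next
    assume "\<forall>l\<in>{?t n <.. ?t n + j}. s l \<noteq> k"
    thus "?t n + j < ?t (Suc n)" using hits by (metis greaterThanAtMost_iff not_less)
  qed
  finally show ?thesis .
qed

lemma le_total_waiting_time:
  assumes "recurs k s"
  shows "n \<le> total_waiting_time k s n"
proof (induction n)
  case (Suc n)
  thus ?case using total_waiting_time_Suc_hits(1)[OF assms, of n] by linarith
qed simp

text \<open>
  The event \<open>total_waiting_time k s n = m\<close> depends only on the first \<open>m\<close> symbols: the total
  waiting times are stopping times. Both sequences must be recurrent, as an infimum over the empty set is \<open>0\<close>.
\<close>

lemma total_waiting_time_cong:
  assumes "recurs k s" "recurs k s'" "\<forall>i\<in>{1..m}. s i = s' i"
    and "total_waiting_time k s n \<le> m"
  shows "total_waiting_time k s' n = total_waiting_time k s n"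
  using assms(4)
proof (induction n)
  case (Suc n)
  note hits = total_waiting_time_Suc_hits[OF assms(1), of n]
  note hits' = total_waiting_time_Suc_hits[OF assms(2), of n]
  have eq: "total_waiting_time k s' n = total_waiting_time k s n"
    using Suc hits(1) by linarith
  let ?t = "total_waiting_time k s (Suc n)" and ?t' = "total_waiting_time k s' (Suc n)"
  have "s' ?t = k"
    using assms(3) hits Suc.prems by (metis atLeastAtMost_iff less_one not_le gr_implies_not0)
  hence 1: "?t' \<le> ?t" using hits(1) eq by (intro total_waiting_time_Suc_le) simp_all
  hence "?t' \<in> {1..m}" using hits'(1) Suc.prems unfolding atLeastAtMost_iff by linarith
  hence "s ?t' = k" using assms(3) hits'(2) by simp
  hence "?t \<le> ?t'" using hits'(1) eq by (intro total_waiting_time_Suc_le) simp_all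
  with 1 show ?case by linarith
qed simp

section \<open>The joint law of the waiting times\<close>

locale iid_occurrences = prob_space M for M :: "'w measure" +
  fixes \<omega> :: "nat \<Rightarrow> 'w \<Rightarrow> nat" and r k :: nat and p :: real
  assumes indep: "indep_vars (\<lambda>_. count_space {1..r}) \<omega> {1..}"
    and prob_k: "1 \<le> i \<Longrightarrow> prob {x \<in> space M. \<omega> i x = k} = p"
    and p: "0 < p" "p < 1"
begin

abbreviation T :: "nat \<Rightarrow> 'w \<Rightarrow> nat" where
  "T n x \<equiv> total_waiting_time k (\<lambda>i. \<omega> i x) n"

abbreviation z :: "nat \<Rightarrow> 'w \<Rightarrow> nat" where
  "z n x \<equiv> waiting_time k (\<lambda>i. \<omega> i x) n"

lemma random_variable_\<omega>: "1 \<le> i \<Longrightarrow> random_variable (count_space {1..r}) (\<omega> i)"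
  using indep by (auto simp: indep_vars_def)

lemma measurable_\<omega>: "1 \<le> i \<Longrightarrow> \<omega> i \<in> measurable M (count_space UNIV)"
  by (rule measurable_compose[OF random_variable_\<omega>]) auto

lemma measurable_total_waiting_time [measurable]: "T n \<in> measurable M (count_space UNIV)"
proof (induction n)
  case (Suc n)
  note [measurable] = Suc
  have "(\<lambda>x. T n x < l \<and> \<omega> l x = k) \<in> measurable M (count_space UNIV)" for l
  proof (cases "1 \<le> l")
    case True
    note [measurable] = measurable_\<omega>[OF True]
    show ?thesis by measurable
  qed (simp add: not_le)
  thus ?case by (simp add: Inf_nat_def)
qed simp

lemma measurable_waiting_time [measurable]: "z n \<in> measurable M (count_space UNIV)"
  unfolding waiting_time_def by measurable

text \<open>
  An event depending only on the symbols \<open>1, \<dots>, m\<close> is the preimage of a set of finite words. All such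
  sets are measurable, so independence of disjoint blocks of symbols applies to any such event.
\<close>

lemma prefix_event_eq:
  assumes "\<And>s s'. \<forall>i\<in>{1..m}. s i = s' i \<Longrightarrow> F s \<longleftrightarrow> F s'"
  shows "{x \<in> space M. F (\<lambda>i. \<omega> i x)} =
    (\<lambda>x. restrict (\<lambda>i. \<omega> i x) {1..m}) -` {s \<in> PiE {1..m} (\<lambda>_. {1..r}). F s} \<inter> space M"
proof -
  have "F (restrict (\<lambda>i. \<omega> i x) {1..m}) \<longleftrightarrow> F (\<lambda>i. \<omega> i x)" for x
    by (intro assms) auto
  moreover have "\<omega> i x \<in> {1..r}" if "x \<in> space M" "i \<in> {1..m}" for x i
    using measurable_space[OF random_variable_\<omega>[of i] that(1)] that(2) by simp
  ultimately show ?thesis by (auto intro!: PiE_I)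
qed

lemma sets_PiM_finite_words: "finite A \<Longrightarrow>
    {s \<in> PiE A (\<lambda>_. {1..r}). F s} \<in> sets (PiM A (\<lambda>_. count_space {1..r}))"
  by (subst count_space_PiM_finite) auto

lemma prefix_event:
  assumes "\<And>s s'. \<forall>i\<in>{1..m}. s i = s' i \<Longrightarrow> F s \<longleftrightarrow> F s'"
  shows "{x \<in> space M. F (\<lambda>i. \<omega> i x)} \<in> events"
proof -
  have "{x \<in> space M. F (\<lambda>i. \<omega> i x)} =
      (\<lambda>x. restrict (\<lambda>i. \<omega> i x) {1..m}) -` {s \<in> PiE {1..m} (\<lambda>_. {1..r}). F s} \<inter> space M"
    by (rule prefix_event_eq) (rule assms)
  also have "\<dots> \<in> events"
  proof (rule measurable_sets)
    show "(\<lambda>x. restrict (\<lambda>i. \<omega> i x) {1..m}) \<in> measurable M (PiM {1..m} (\<lambda>_. count_space {1..r}))"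
      by (rule measurable_restrict) (rule random_variable_\<omega>, simp)
  qed (rule sets_PiM_finite_words, simp)
  finally show ?thesis .
qed

lemma prob_prefix_and_miss_next:
  assumes F: "\<And>s s'. \<forall>i\<in>{1..m}. s i = s' i \<Longrightarrow> F s \<longleftrightarrow> F s'"
  shows "prob {x \<in> space M. F (\<lambda>i. \<omega> i x) \<and> \<omega> (Suc m) x \<noteq> k} =
    prob {x \<in> space M. F (\<lambda>i. \<omega> i x)} * (1 - p)"
proof -
  define A where "A = {s \<in> PiE {1..m} (\<lambda>_. {1..r}). F s}"
  define B where "B = {s \<in> PiE {Suc m} (\<lambda>_. {1..r}). s (Suc m) \<noteq> k}"
  let ?f = "\<lambda>x. restrict (\<lambda>i. \<omega> i x) {1..m}" and ?g = "\<lambda>x. restrict (\<lambda>i. \<omega> i x) {Suc m}"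
  have "indep_var (PiM {1..m} (\<lambda>_. count_space {1..r})) ?f (PiM {Suc m} (\<lambda>_. count_space {1..r})) ?g"
    by (rule indep_var_restrict[OF indep]) auto
  hence prod: "prob ((\<lambda>x. (?f x, ?g x)) -` (A \<times> B) \<inter> space M) =
      prob (?f -` A \<inter> space M) * prob (?g -` B \<inter> space M)"
    by (rule indep_varD) (unfold A_def B_def, (rule sets_PiM_finite_words, simp)+)
  have fA: "?f -` A \<inter> space M = {x \<in> space M. F (\<lambda>i. \<omega> i x)}"
    unfolding A_def by (rule prefix_event_eq[symmetric]) (rule F)
  have range: "\<omega> (Suc m) x \<in> {1..r}" if "x \<in> space M" for x
    using measurable_space[OF random_variable_\<omega>[of "Suc m"] that] by simp
  have gB: "?g -` B \<inter> space M = {x \<in> space M. \<omega> (Suc m) x \<noteq> k}"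
    using range by (auto simp: B_def intro!: PiE_I)
  have "(\<lambda>x. (?f x, ?g x)) -` (A \<times> B) \<inter> space M = (?f -` A \<inter> space M) \<inter> (?g -` B \<inter> space M)"
    by auto
  also have "\<dots> = {x \<in> space M. F (\<lambda>i. \<omega> i x) \<and> \<omega> (Suc m) x \<noteq> k}"
    unfolding fA gB by auto
  finally have "prob {x \<in> space M. F (\<lambda>i. \<omega> i x) \<and> \<omega> (Suc m) x \<noteq> k} =
      prob {x \<in> space M. F (\<lambda>i. \<omega> i x)} * prob {x \<in> space M. \<omega> (Suc m) x \<noteq> k}"
    using prod unfolding fA gB by simp
  moreover have "prob {x \<in> space M. \<omega> (Suc m) x \<noteq> k} = 1 - p"
  proof -
    note [measurable] = measurable_\<omega>[of "Suc m"]
    have "{x \<in> space M. \<omega> (Suc m) x = k} \<in> events" by measurable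
    thus ?thesis using prob_neg[of "\<lambda>x. \<omega> (Suc m) x = k"] prob_k[of "Suc m"] by simp
  qed
  ultimately show ?thesis by simp
qed

lemma prob_prefix_and_miss:
  assumes F: "\<And>s s'. \<forall>i\<in>{1..m}. s i = s' i \<Longrightarrow> F s \<longleftrightarrow> F s'"
  shows "prob {x \<in> space M. F (\<lambda>i. \<omega> i x) \<and> (\<forall>l\<in>{m<..m + j}. \<omega> l x \<noteq> k)} =
    prob {x \<in> space M. F (\<lambda>i. \<omega> i x)} * (1 - p) ^ j"
proof (induction j)
  case (Suc j)
  let ?F = "\<lambda>s. F s \<and> (\<forall>l\<in>{m<..m + j}. s l \<noteq> k)"
  have split: "(\<forall>l\<in>{m<..m + Suc j}. \<omega> l x \<noteq> k) \<longleftrightarrow>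
      (\<forall>l\<in>{m<..m + j}. \<omega> l x \<noteq> k) \<and> \<omega> (Suc (m + j)) x \<noteq> k" for x
    by (auto simp: le_Suc_eq)
  have "prob {x \<in> space M. ?F (\<lambda>i. \<omega> i x) \<and> \<omega> (Suc (m + j)) x \<noteq> k} =
      prob {x \<in> space M. ?F (\<lambda>i. \<omega> i x)} * (1 - p)"
  proof (rule prob_prefix_and_miss_next)
    fix s s' :: "nat \<Rightarrow> nat" assume "\<forall>i\<in>{1..m + j}. s i = s' i"
    thus "?F s \<longleftrightarrow> ?F s'" using F[of s s'] by auto
  qed
  thus ?case unfolding split using Suc.IH by (simp add: conj_assoc)
qed simp

text \<open>
  The probability that \<open>k\<close> is missing from all positions after \<open>m\<close> is at most \<open>(1 - p) ^ j\<close> for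
  every \<open>j\<close>, hence zero, and there are countably many \<open>m\<close>.
\<close>

lemma AE_recurs: "AE x in M. recurs k (\<lambda>i. \<omega> i x)"
  unfolding recurs_def
proof (subst AE_all_countable, rule allI)
  fix m
  let ?N = "{x \<in> space M. \<forall>l>m. \<omega> l x \<noteq> k}"
  have meas: "{x \<in> space M. \<forall>l\<in>{m<..m + j}. \<omega> l x \<noteq> k} \<in> events" for j
    by (rule prefix_event[of "m + j" "\<lambda>s. \<forall>l\<in>{m<..m + j}. s l \<noteq> k"]) auto
  have N: "?N = (\<Inter>j. {x \<in> space M. \<forall>l\<in>{m<..m + j}. \<omega> l x \<noteq> k})"
  proof -
    have "\<omega> l x \<noteq> k" if "\<forall>j. \<forall>l\<in>{m<..m + j}. \<omega> l x \<noteq> k" "m < l" for x l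
      using spec[OF that(1), of l] that(2) by simp
    thus ?thesis by auto
  qed
  have N_meas: "?N \<in> events" unfolding N using meas by blast
  have "prob ?N \<le> (1 - p) ^ j" for j
  proof -
    have "prob ?N \<le> prob {x \<in> space M. \<forall>l\<in>{m<..m + j}. \<omega> l x \<noteq> k}"
      using meas by (intro finite_measure_mono) auto
    also have "\<dots> = (1 - p) ^ j"
      using prob_prefix_and_miss[of m "\<lambda>_. True" j] by (simp add: prob_space)
    finally show ?thesis .
  qed
  moreover have "(\<lambda>j. (1 - p) ^ j) \<longlonglongrightarrow> 0" using p by (intro LIMSEQ_power_zero) auto
  ultimately have "prob ?N \<le> 0" by (intro LIMSEQ_le_const) auto
  hence "prob ?N = 0" by (simp add: measure_le_0_iff)
  hence "AE x in M. \<not> (\<forall>l>m. \<omega> l x \<noteq> k)"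
    by (rule prob_Collect_eq_0[OF N_meas, THEN iffD1])
  thus "AE x in M. \<exists>l>m. \<omega> l x = k" by eventually_elim blast
qed

text \<open>
  Given that the \<open>n\<close>-th occurrence is at position \<open>m\<close>, the next waiting time exceeds \<open>j\<close> iff the
  following \<open>j\<close> symbols miss \<open>k\<close>, which is independent of the first \<open>m\<close> symbols. To get an event that
  depends on these symbols on every path and not only on recurrent ones, the later symbols are
  replaced by \<open>k\<close>; the modified path is always recurrent.
\<close>

lemma prob_total_and_less_waiting:
  "prob {x \<in> space M. T n x = m \<and> j < z (Suc n) x} = prob {x \<in> space M. T n x = m} * (1 - p) ^ j"
proof -
  define F where "F s \<longleftrightarrow> total_waiting_time k (\<lambda>i. if i \<in> {1..m} then s i else k) n = m" for s
  have F_cong: "F s \<longleftrightarrow> F s'" if "\<forall>i\<in>{1..m}. s i = s' i" for s s'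
  proof -
    have "(\<lambda>i. if i \<in> {1..m} then s i else k) = (\<lambda>i. if i \<in> {1..m} then s' i else k)"
      using that by auto
    thus ?thesis unfolding F_def by simp
  qed
  have F_iff: "F s \<longleftrightarrow> total_waiting_time k s n = m" if s: "recurs k s" for s
  proof -
    define s' where "s' = (\<lambda>i. if i \<in> {1..m} then s i else k)"
    have s': "recurs k s'"
      unfolding recurs_def
    proof
      fix i show "\<exists>l>i. s' l = k" by (rule exI[of _ "Suc (i + m)"]) (auto simp: s'_def)
    qed
    have agree: "\<forall>i\<in>{1..m}. s i = s' i" by (simp add: s'_def)
    show ?thesis unfolding F_def s'_def[symmetric]
      using total_waiting_time_cong[OF s s' agree, of n]
        total_waiting_time_cong[OF s' s, of m n] agree by auto
  qed
  have E: "{x \<in> space M. F (\<lambda>i. \<omega> i x)} \<in> events" by (rule prefix_event) (rule F_cong)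
  have E': "{x \<in> space M. F (\<lambda>i. \<omega> i x) \<and> (\<forall>l\<in>{m<..m + j}. \<omega> l x \<noteq> k)} \<in> events"
  proof (rule prefix_event[of "m + j"])
    fix s s' :: "nat \<Rightarrow> nat" assume "\<forall>i\<in>{1..m + j}. s i = s' i"
    thus "(F s \<and> (\<forall>l\<in>{m<..m + j}. s l \<noteq> k)) \<longleftrightarrow> (F s' \<and> (\<forall>l\<in>{m<..m + j}. s' l \<noteq> k))"
      using F_cong[of s s'] by auto
  qed
  have "prob {x \<in> space M. T n x = m \<and> j < z (Suc n) x} =
      prob {x \<in> space M. F (\<lambda>i. \<omega> i x) \<and> (\<forall>l\<in>{m<..m + j}. \<omega> l x \<noteq> k)}"
  proof (rule prob_eq_AE)
    show "AE x in M. (T n x = m \<and> j < z (Suc n) x) \<longleftrightarrow>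
        F (\<lambda>i. \<omega> i x) \<and> (\<forall>l\<in>{m<..m + j}. \<omega> l x \<noteq> k)"
      using AE_recurs by eventually_elim (auto simp: F_iff less_waiting_time_iff)
  qed (use E' in measurable)
  also have "\<dots> = prob {x \<in> space M. F (\<lambda>i. \<omega> i x)} * (1 - p) ^ j"
    by (rule prob_prefix_and_miss) (rule F_cong)
  also have "prob {x \<in> space M. F (\<lambda>i. \<omega> i x)} = prob {x \<in> space M. T n x = m}"
  proof (rule prob_eq_AE)
    show "AE x in M. F (\<lambda>i. \<omega> i x) \<longleftrightarrow> T n x = m"
      using AE_recurs by eventually_elim (simp add: F_iff)
  qed (use E in measurable)
  finally show ?thesis .
qed

text \<open>
  The value at \<open>0\<close> is \<open>0\<close>, so that convolutions may run over all splittings \<open>l = m + (l - m)\<close>.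
\<close>

definition geometric :: "nat \<Rightarrow> real" where
  "geometric j = (if j = 0 then 0 else p * (1 - p) ^ (j - 1))"

text \<open>
  Point probabilities of the waiting time are differences of consecutive tail probabilities, and
  \<open>(1 - p) ^ i - (1 - p) ^ Suc i = p (1 - p) ^ i\<close>.
\<close>

lemma prob_total_and_waiting:
  "prob {x \<in> space M. T n x = m \<and> z (Suc n) x = j} = prob {x \<in> space M. T n x = m} * geometric j"
proof (cases j)
  case 0
  have "AE x in M. 0 < z (Suc n) x"
    using AE_recurs by eventually_elim (simp add: less_waiting_time_iff)
  hence "prob {x \<in> space M. T n x = m \<and> z (Suc n) x = j} = 0"
    using 0 by (subst prob_Collect_eq_0) (auto elim: eventually_mono)
  thus ?thesis using 0 by (simp add: geometric_def)
next
  case (Suc i)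
  have meas: "{x \<in> space M. T n x = m \<and> l < z (Suc n) x} \<in> events" for l
    by measurable
  have eq: "{x \<in> space M. T n x = m \<and> z (Suc n) x = j} =
      {x \<in> space M. T n x = m \<and> i < z (Suc n) x} - {x \<in> space M. T n x = m \<and> j < z (Suc n) x}"
    using Suc by auto
  have "prob {x \<in> space M. T n x = m \<and> z (Suc n) x = j} =
      prob {x \<in> space M. T n x = m \<and> i < z (Suc n) x} -
      prob {x \<in> space M. T n x = m \<and> j < z (Suc n) x}"
    unfolding eq using Suc by (intro finite_measure_Diff meas) auto
  also have "\<dots> = prob {x \<in> space M. T n x = m} * ((1 - p) ^ i - (1 - p) ^ j)"
    by (simp only: prob_total_and_less_waiting right_diff_distrib)
  also have "(1 - p) ^ i - (1 - p) ^ j = geometric j"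
    using Suc by (simp add: geometric_def algebra_simps)
  finally show ?thesis .
qed

text \<open>
  On recurrent paths \<open>T (Suc n) = T n + z (Suc n)\<close>, and the joint law of the two summands is a product,
  so their laws are convolved.
\<close>

lemma prob_total_Suc:
  "prob {x \<in> space M. T (Suc n) x = l} =
    (\<Sum>m\<le>l. prob {x \<in> space M. T n x = m} * geometric (l - m))"
proof -
  let ?A = "\<lambda>m. {x \<in> space M. T n x = m \<and> z (Suc n) x = l - m}"
  have "prob {x \<in> space M. T (Suc n) x = l} =
      prob {x \<in> space M. \<exists>m\<in>{..l}. T n x = m \<and> z (Suc n) x = l - m}"
  proof (rule prob_eq_AE)
    show "AE x in M. (T (Suc n) x = l) = (\<exists>m\<in>{..l}. T n x = m \<and> z (Suc n) x = l - m)"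
      using AE_recurs
    proof eventually_elim
      case (elim x)
      have "z (Suc n) x = T (Suc n) x - T n x" by (simp only: waiting_time_def diff_Suc_1)
      thus ?case using total_waiting_time_Suc_hits(1)[OF elim, of n]
        by (auto simp del: total_waiting_time.simps)
    qed
  qed measurable
  also have "{x \<in> space M. \<exists>m\<in>{..l}. T n x = m \<and> z (Suc n) x = l - m} = (\<Union>m\<in>{..l}. ?A m)"
    by auto
  also have "prob (\<Union>m\<in>{..l}. ?A m) = (\<Sum>m\<le>l. prob (?A m))"
    by (intro finite_measure_finite_Union) (auto simp: disjoint_family_on_def)
  finally show ?thesis unfolding prob_total_and_waiting .
qed

lemma geometric_generating_function:
  assumes "0 \<le> s" "s \<le> 1"
  shows "(\<lambda>j. geometric j * s ^ j) sums (p * s / (1 - (1 - p) * s))"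
proof -
  have "norm ((1 - p) * s) = (1 - p) * s" using p assms by (simp add: abs_mult)
  also have "\<dots> \<le> 1 - p" using p assms by (intro mult_left_le) auto
  also have "\<dots> < 1" using p by simp
  finally have "norm ((1 - p) * s) < 1" .
  from sums_mult[OF geometric_sums[OF this], of "p * s"]
  have "(\<lambda>j. geometric (Suc j) * s ^ Suc j) sums (p * s / (1 - (1 - p) * s))"
    by (simp add: geometric_def power_mult_distrib ac_simps)
  from sums_Suc[OF this] show ?thesis by (simp add: geometric_def)
qed

text \<open>
  Convolution of laws is the Cauchy product of generating functions; \<open>T n\<close> is negative binomial.
\<close>

lemma total_waiting_time_generating_function:
  assumes "0 \<le> s" "s \<le> 1"
  shows "(\<lambda>m. prob {x \<in> space M. T n x = m} * s ^ m) sums (p * s / (1 - (1 - p) * s)) ^ n"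
proof (induction n)
  case 0
  have "(\<lambda>m. prob {x \<in> space M. T 0 x = m} * s ^ m) = (\<lambda>m. if m = 0 then 1 else 0)"
    by (auto simp: prob_space)
  thus ?case using sums_single[of 0 "\<lambda>_. 1::real"] by simp
next
  case (Suc n)
  let ?a = "\<lambda>m. prob {x \<in> space M. T n x = m} * s ^ m" and ?b = "\<lambda>j. geometric j * s ^ j"
  note b = geometric_generating_function[OF assms]
  have norm: "norm (?a m) = ?a m" "norm (?b m) = ?b m" for m
    using assms p by (simp_all add: abs_mult geometric_def)
  have "(\<lambda>l. \<Sum>m\<le>l. ?a m * ?b (l - m)) sums (suminf ?a * suminf ?b)"
    using Suc.IH b by (intro Cauchy_product_sums) (simp_all only: norm sums_iff)
  moreover have "(\<Sum>m\<le>l. ?a m * ?b (l - m)) = prob {x \<in> space M. T (Suc n) x = l} * s ^ l" for l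
    unfolding prob_total_Suc sum_distrib_right
    by (intro sum.cong refl) (simp add: power_add[symmetric])
  moreover have "suminf ?a * suminf ?b = (p * s / (1 - (1 - p) * s)) ^ Suc n"
    using Suc.IH b by (simp add: sums_iff)
  ultimately show ?case by simp
qed

lemma less_waiting_event: "{x \<in> space M. h (T n x) < z (Suc n) x} \<in> events"
proof -
  have "{x \<in> space M. h (T n x) < z (Suc n) x} =
      (\<Union>m. {x \<in> space M. T n x = m \<and> h m < z (Suc n) x})" by auto
  also have "\<dots> \<in> events" by (intro sets.countable_UN) auto
  finally show ?thesis .
qed

text \<open>
  The threshold may depend on the position of the \<open>n\<close>-th occurrence; comparing the ratio with \<open>q\<close>
  leads to thresholds obtained by rounding \<open>q * T n\<close>.
\<close>

lemma prob_less_waiting_sums: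
  "(\<lambda>m. prob {x \<in> space M. T n x = m} * (1 - p) ^ h m) sums
    prob {x \<in> space M. h (T n x) < z (Suc n) x}"
proof -
  let ?A = "\<lambda>m. {x \<in> space M. T n x = m \<and> h m < z (Suc n) x}"
  have "(\<lambda>m. prob (?A m)) sums prob (\<Union>m. ?A m)"
    by (intro finite_measure_UNION) (auto simp: disjoint_family_on_def)
  moreover have "(\<Union>m. ?A m) = {x \<in> space M. h (T n x) < z (Suc n) x}" by auto
  ultimately show ?thesis by (simp only: prob_total_and_less_waiting)
qed

section \<open>Tails of the waiting ratio\<close>

abbreviation Q :: "nat \<Rightarrow> real measure" where
  "Q \<equiv> waiting_ratio_distr M \<omega> k"

lemma measurable_ratio:
  "(\<lambda>x. real (z (Suc n) x) / real (T n x)) \<in> borel_measurable M"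
proof -
  have "(\<lambda>x. real (z (Suc n) x)) \<in> borel_measurable M"
    by (rule measurable_compose[OF measurable_waiting_time]) simp
  moreover have "(\<lambda>x. real (T n x)) \<in> borel_measurable M"
    by (rule measurable_compose[OF measurable_total_waiting_time]) simp
  ultimately show ?thesis by (rule borel_measurable_divide)
qed

lemma ratio_event:
  "A \<in> sets borel \<Longrightarrow> {x \<in> space M. real (z (Suc n) x) / real (T n x) \<in> A} \<in> events"
  using measurable_sets[OF measurable_ratio, of A n]
  by (simp add: vimage_def Int_def conj_commute)

lemma measure_Q:
  assumes "A \<in> sets borel"
  shows "measure (Q n) A = prob {x \<in> space M. real (z (Suc n) x) / real (T n x) \<in> A}"
  unfolding waiting_ratio_distr_def
  using measurable_ratio assms by (subst measure_distr) (auto intro!: arg_cong[where f = prob])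

text \<open>
  The expectation of \<open>(1 - p) powr (q * T n)\<close>, that is, the generating function of \<open>T n\<close> at
  \<open>s = (1 - p) powr q\<close>.
\<close>

lemma tail_sums:
  assumes "0 \<le> q"
  shows "(\<lambda>m. prob {x \<in> space M. T n x = m} * (1 - p) powr (q * real m)) sums
    exp (- real n * explicit_rate p q)"
proof -
  have "(1 - p) powr q \<le> (1 - p) powr 0" using p assms by (intro powr_mono') auto
  hence s: "(1 - p) powr q \<le> 1" using p by simp
  have pw: "((1 - p) powr q) ^ m = (1 - p) powr (q * real m)" for m
    using p by (simp add: powr_powr[symmetric] powr_realpow)
  have "exp (- real n * explicit_rate p q) = exp (- explicit_rate p q) ^ n"
    by (simp add: exp_of_nat_mult[symmetric])
  thus ?thesis
    using total_waiting_time_generating_function[of "(1 - p) powr q" n] s p assms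
    by (simp add: pw exp_minus_explicit_rate)
qed

text \<open>
  The ratio exceeds \<open>q\<close> iff the next waiting time exceeds \<open>\<lfloor>q m\<rfloor>\<close>, where \<open>m = T n\<close>; this has conditional
  probability \<open>(1 - p) ^ \<lfloor>q m\<rfloor> \<ge> (1 - p) powr (q m)\<close>.
\<close>

lemma lower_tail:
  assumes "1 \<le> n" "0 \<le> q"
  shows "exp (- real n * explicit_rate p q) \<le> measure (Q n) {q<..}"
proof -
  define h where "h m = nat \<lfloor>q * real m\<rfloor>" for m :: nat
  have "exp (- real n * explicit_rate p q) \<le> prob {x \<in> space M. h (T n x) < z (Suc n) x}"
  proof (rule sums_le[OF _ tail_sums[OF assms(2)] prob_less_waiting_sums])
    fix m
    have "(1 - p) powr (q * real m) \<le> (1 - p) powr (real (h m))"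
      using p assms by (intro powr_mono') (auto simp: h_def)
    thus "prob {x \<in> space M. T n x = m} * (1 - p) powr (q * real m)
        \<le> prob {x \<in> space M. T n x = m} * (1 - p) ^ h m"
      using p by (intro mult_left_mono) (auto simp: powr_realpow)
  qed
  also have "\<dots> = measure (Q n) {q<..}"
    unfolding measure_Q[OF borel_open[OF open_greaterThan]]
  proof (rule prob_eq_AE)
    show "AE x in M. (h (T n x) < z (Suc n) x) = (real (z (Suc n) x) / real (T n x) \<in> {q<..})"
      using AE_recurs
    proof eventually_elim
      case (elim x)
      have "0 < T n x" using le_total_waiting_time[OF elim, of n] assms by linarith
      moreover have "h (T n x) < z (Suc n) x \<longleftrightarrow> q * real (T n x) < real (z (Suc n) x)"
        using assms unfolding h_def
        by (metis floor_less_iff nat_less_iff mult_nonneg_nonneg of_int_of_nat_eq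
            of_nat_0_le_iff zero_le_floor)
      ultimately show ?case by (simp add: less_divide_eq)
    qed
  qed (intro less_waiting_event ratio_event borel_open[OF open_greaterThan])+
  finally show ?thesis .
qed

text \<open>
  Here the threshold is \<open>\<lceil>q m\<rceil> - 1 \<ge> q m - 1\<close>; the subtracted unit costs the factor \<open>1 / (1 - p)\<close>. For
  \<open>q = 0\<close> the natural number \<open>nat (-1) = 0\<close> is still a valid threshold because waiting times are
  positive.
\<close>

lemma upper_tail:
  assumes "1 \<le> n" "0 \<le> q"
  shows "measure (Q n) {q..} \<le> inverse (1 - p) * exp (- real n * explicit_rate p q)"
proof -
  define h where "h m = nat (\<lceil>q * real m\<rceil> - 1)" for m :: nat
  have "measure (Q n) {q..} \<le> prob {x \<in> space M. h (T n x) < z (Suc n) x}"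
    unfolding measure_Q[OF borel_closed[OF closed_atLeast]]
  proof (rule finite_measure_mono_AE)
    show "AE x in M. x \<in> {x \<in> space M. real (z (Suc n) x) / real (T n x) \<in> {q..}} \<longrightarrow>
        x \<in> {x \<in> space M. h (T n x) < z (Suc n) x}"
      using AE_recurs
    proof eventually_elim
      case (elim x)
      have T: "0 < T n x" using le_total_waiting_time[OF elim, of n] assms by linarith
      have z: "0 < z (Suc n) x" using elim by (simp add: less_waiting_time_iff)
      have "h (T n x) < z (Suc n) x" if "q * real (T n x) \<le> real (z (Suc n) x)"
      proof -
        have "\<lceil>q * real (T n x)\<rceil> \<le> int (z (Suc n) x)" using that by (simp add: ceiling_le_iff)
        thus ?thesis using z unfolding h_def by linarith
      qed
      thus ?case using T by (auto simp: le_divide_eq)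
    qed
  qed (intro less_waiting_event)
  also have "\<dots> \<le> inverse (1 - p) * exp (- real n * explicit_rate p q)"
  proof (rule sums_le[OF _ prob_less_waiting_sums sums_mult[OF tail_sums[OF assms(2)]]])
    fix m
    have "q * real m - 1 \<le> real (h m)" unfolding h_def by linarith
    hence "(1 - p) powr (real (h m)) \<le> (1 - p) powr (q * real m - 1)"
      using p by (intro powr_mono') auto
    also have "\<dots> = inverse (1 - p) * (1 - p) powr (q * real m)"
      using p by (simp add: powr_diff field_simps)
    finally have "(1 - p) ^ h m \<le> inverse (1 - p) * (1 - p) powr (q * real m)"
      using p by (simp add: powr_realpow)
    from mult_left_mono[OF this, of "prob {x \<in> space M. T n x = m}"]
    show "prob {x \<in> space M. T n x = m} * (1 - p) ^ h m
        \<le> inverse (1 - p) * (prob {x \<in> space M. T n x = m} * (1 - p) powr (q * real m))"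
      by (simp add: ac_simps)
  qed
  finally show ?thesis .
qed

lemma measure_Q_nonpos:
  assumes "1 \<le> n"
  shows "measure (Q n) {..0} = 0"
proof -
  have "AE x in M. real (z (Suc n) x) / real (T n x) > 0"
    using AE_recurs
  proof eventually_elim
    case (elim x)
    have "0 < T n x" using le_total_waiting_time[OF elim, of n] assms by linarith
    moreover have "0 < z (Suc n) x" using elim by (simp add: less_waiting_time_iff)
    ultimately show ?case by simp
  qed
  hence "prob {x \<in> space M. real (z (Suc n) x) / real (T n x) \<in> {..0}} = 0"
    by (subst prob_Collect_eq_0[OF ratio_event]) (auto elim: eventually_mono)
  thus ?thesis by (simp add: measure_Q)
qed

lemma exponential_tails_waiting_ratio:
  "exponential_tails Q (explicit_rate p) (inverse (1 - p))"
proof (rule exponential_tails.intro)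
  show "prob_space (Q n)" if "1 \<le> n" for n
    unfolding waiting_ratio_distr_def
    using measurable_ratio[of n] by (intro prob_space_distr) simp
  show "sets (Q n) = sets borel" if "1 \<le> n" for n by (simp add: waiting_ratio_distr_def)
qed (use p lower_tail upper_tail measure_Q_nonpos strict_mono_on_explicit_rate
    continuous_on_explicit_rate filterlim_explicit_rate_at_top in simp_all)

end

section \<open>The large deviation principle for the waiting ratio\<close>

lemma rate_fun_eq:
  assumes "0 < p" "p < 1"
  shows "rate_fun p = (\<lambda>q. if 0 < q then ereal (explicit_rate p q) else \<infinity>)"
  using assms by (auto simp: rate_fun_def rate_formula_eq_explicit_rate)

theorem corollary4:
  fixes M :: "'w measure" and r k :: nat and P :: "nat \<Rightarrow> real" and \<omega> :: "nat \<Rightarrow> 'w \<Rightarrow> nat"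
    and p :: real
  assumes "bernoulli_process M r P \<omega>"
    and "k \<in> {1..r}"
    and "p = P k"
    and "0 < p" and "p < 1"
  shows "large_deviation_principle real (waiting_ratio_distr M \<omega> k) (rate_fun_lsc p)
    \<and> ld_upper_bound real (waiting_ratio_distr M \<omega> k) (rate_fun p)
    \<and> ld_lower_bound real (waiting_ratio_distr M \<omega> k) (rate_fun p)
    \<and> strict_mono_on {0<..} (rate_fun p)
    \<and> concave_on {0<..} (rate_formula p)"
proof -
  interpret prob_space M using assms(1) by (simp add: bernoulli_process_def)
  interpret iid_occurrences M \<omega> r k p
    by unfold_locales (use assms in \<open>auto simp: bernoulli_process_def\<close>)
  interpret Q: exponential_tails Q "explicit_rate p" "inverse (1 - p)"
    by (rule exponential_tails_waiting_ratio)
  have lsc: "rate_fun_lsc p = Q.rate"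
    using assms(4,5) by (auto simp: rate_fun_lsc_def rate_fun_eq Q.rate_def)
  have off_zero: "rate_fun p = Q.rate(0 := \<infinity>)"
    using assms(4,5) by (auto simp: rate_fun_eq Q.rate_def)
  have mono: "strict_mono_on {0<..} (rate_fun p)"
  proof (rule strict_mono_onI)
    fix x y :: real assume "x \<in> {0<..}" "y \<in> {0<..}" "x < y"
    thus "rate_fun p x < rate_fun p y"
      using strict_mono_onD[OF Q.J_strict, of x y] assms(4,5) by (simp add: rate_fun_eq)
  qed
  have "concave_on {0<..} (explicit_rate p)"
    using concave_on_explicit_rate[OF assms(4,5)] unfolding concave_on_def
    by (rule convex_on_subset) auto
  hence "concave_on {0<..} (rate_formula p)"
    unfolding concave_on_iff using assms(4,5)
    by (auto simp: rate_formula_eq_explicit_rate add_nonneg_nonneg)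
  with mono show ?thesis
    unfolding lsc off_zero
    using Q.large_deviation_principle_rate Q.ld_upper_bound_off_zero Q.ld_lower_bound_off_zero
    by simp
qed

end
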